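(* (i) Let $\gamma_0>0$, $N_{\rm th}\ge 0$, $r\in\mathbb{R}$, $\Phi\in\mathbb{R}$, $t>0$, and let $\mathcal{E}$ be the corresponding squeezed generalized amplitude damping (SGAD) channel on a qubit. The eigenvalues of its Choi matrix $C_{\mathcal{E}}$ are $$e_\pm=\tfrac12\left(1-H\pm\sqrt{(A-G)^2+4B^2+Y^2}\right),\qquad f_\pm=\tfrac12\left(1+H\pm\sqrt{(A+G)^2+Y^2}\right).$$ Moreover $e_-=0$ if and only if $f_-=0$, and this happens if and only if $N_{\rm th}=0$ and $r=0$. Consequently the rank of $C_{\mathcal{E}}$ is either $2$ or $4$: it is $2$ if $N_{\rm th}=r=0$, and $4$ otherwise. (ii) In contrast, for every $k\in\{1,2,3,4\}$ there is a Pauli (generalized depolarizing) channel on a qubit whose Choi matrix has rank $k$.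
   Context: Let $\sigma_x,\sigma_y,\sigma_z$ be the standard Pauli matrices. For a linear map $\mathcal{E}$ on $2\times 2$ complex matrices, its Choi matrix is $C_{\mathcal{E}}=(I\otimes\mathcal{E})(|\tilde\psi\rangle\langle\tilde\psi|)$ with $|\tilde\psi\rangle=|00\rangle+|11\rangle$ (unnormalized), where $|0\rangle,|1\rangle$ is the standard basis. A Pauli (generalized depolarizing) channel is a map $\rho\mapsto \alpha\rho+\beta\sigma_x\rho\sigma_x+\gamma\sigma_y\rho\sigma_y+\delta\sigma_z\rho\sigma_z$ with $\alpha,\beta,\gamma,\delta\ge0$ and $\alpha+\beta+\gamma+\delta=1$. The SGAD channel describes a qubit interacting with a squeezed thermal bath. Its parameters are: the spontaneous emission rate $\gamma_0>0$; the thermal photon number $N_{\rm th}=1/(e^{\hbar\omega/k_BT}-1)\ge 0$ (with $N_{\rm th}=0$ iff the temperature $T=0$); the bath squeezing parameters $r,\Phi\in\mathbb{R}$; and the time $t\ge 0$. Put $$N=N_{\rm th}(\cosh^2 r+\sinh^2 r)+\sinh^2 r,\qquad a=\sinh(2r)(2N_{\rm th}+1),$$ $$A=\left[1+\tfrac12(e^{\gamma_0 a t}-1)(1+\cos\Phi)\right]e^{-\gamma_0(2N+1+a)t/2},$$ $$G=\left[1+\tfrac12(e^{\gamma_0 a t}-1)(1-\cos\Phi)\right]e^{-\gamma_0(2N+1+a)t/2},$$ $$B=\sin\Phi\,\sinh\!\left(\tfrac{\gamma_0 a t}{2}\right)e^{-\gamma_0(2N+1)t/2},\qquad H=e^{-\gamma_0(2N+1)t},\qquad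 Y=\frac{1-H}{2N+1}.$$ The SGAD channel is the linear map $\mathcal{E}$ on $2\times2$ complex matrices defined by $$\mathcal{E}(I)=I-Y\sigma_z,\quad \mathcal{E}(\sigma_x)=A\sigma_x-B\sigma_y,\quad \mathcal{E}(\sigma_y)=-B\sigma_x+G\sigma_y,\quad \mathcal{E}(\sigma_z)=H\sigma_z.$$ *)

theory Defs
  imports Complex_Main "Jordan_Normal_Form.Char_Poly" "Jordan_Normal_Form.DL_Rank"
begin

section \<open>Qubit operators\<close>

definition pauli_x :: "complex mat" where
  "pauli_x = mat_of_rows_list 2 [[0, 1], [1, 0]]"

definition pauli_y :: "complex mat" where
  "pauli_y = mat_of_rows_list 2 [[0, - \<i>], [\<i>, 0]]"

definition pauli_z :: "complex mat" where
  "pauli_z = mat_of_rows_list 2 [[1, 0], [0, - 1]]"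

text \<open>A map on matrices counts as a linear map on 2 x 2 matrices according to its
  restriction to \<^term>\<open>carrier_mat 2 2\<close>; its values elsewhere are irrelevant.\<close>

definition qubit_linear :: "(complex mat \<Rightarrow> complex mat) \<Rightarrow> bool" where
  "qubit_linear E \<longleftrightarrow>
     (\<forall>X \<in> carrier_mat 2 2. E X \<in> carrier_mat 2 2) \<and>
     (\<forall>X \<in> carrier_mat 2 2. \<forall>Y \<in> carrier_mat 2 2. E (X + Y) = E X + E Y) \<and>
     (\<forall>c. \<forall>X \<in> carrier_mat 2 2. E (c \<cdot>\<^sub>m X) = c \<cdot>\<^sub>m E X)"


section \<open>Choi matrix\<close>

text \<open>Tensor products use the lexicographic order of the basis: the index of
  \<open>|i\<rangle> \<otimes> |j\<rangle>\<close> is \<open>i * d + j\<close>, with \<open>d\<close> the dimension of the second factor.\<close>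

definition tensor_vec :: "complex vec \<Rightarrow> complex vec \<Rightarrow> complex vec" where
  "tensor_vec u v =
     vec (dim_vec u * dim_vec v) (\<lambda>i. u $ (i div dim_vec v) * v $ (i mod dim_vec v))"

definition tensor_mat :: "complex mat \<Rightarrow> complex mat \<Rightarrow> complex mat" where
  "tensor_mat X Y = mat (dim_row X * dim_row Y) (dim_col X * dim_col Y)
     (\<lambda>(i, j). X $$ (i div dim_row Y, j div dim_col Y) * Y $$ (i mod dim_row Y, j mod dim_col Y))"

definition ket_bra :: "complex vec \<Rightarrow> complex vec \<Rightarrow> complex mat" where
  "ket_bra u v = mat (dim_vec u) (dim_vec v) (\<lambda>(i, j). u $ i * cnj (v $ j))"

text \<open>\<open>I \<otimes> E\<close> applies \<open>E\<close> to each 2 x 2 block of a 4 x 4 matrix; lemma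
  \<open>id_tensor_tensor_mat\<close> below gives its action on product operators.\<close>

definition id_tensor :: "(complex mat \<Rightarrow> complex mat) \<Rightarrow> complex mat \<Rightarrow> complex mat" where
  "id_tensor E M = mat 4 4 (\<lambda>(p, q).
     E (mat 2 2 (\<lambda>(i, j). M $$ (2 * (p div 2) + i, 2 * (q div 2) + j))) $$ (p mod 2, q mod 2))"

definition bell_vec :: "complex vec" where
  "bell_vec = tensor_vec (unit_vec 2 0) (unit_vec 2 0) + tensor_vec (unit_vec 2 1) (unit_vec 2 1)"

definition choi :: "(complex mat \<Rightarrow> complex mat) \<Rightarrow> complex mat" where
  "choi E = id_tensor E (ket_bra bell_vec bell_vec)"

lemma id_tensor_tensor_mat:
  assumes "qubit_linear E" "X \<in> carrier_mat 2 2" "Y \<in> carrier_mat 2 2"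
  shows "id_tensor E (tensor_mat X Y) = tensor_mat X (E Y)"
proof -
  have EY: "E Y \<in> carrier_mat 2 2" using assms unfolding qubit_linear_def by blast
  have blk: "mat 2 2 (\<lambda>(i, j). tensor_mat X Y $$ (2 * (p div 2) + i, 2 * (q div 2) + j))
      = X $$ (p div 2, q div 2) \<cdot>\<^sub>m Y" if "p < 4" "q < 4" for p q
  proof (rule eq_matI)
    fix i j assume "i < dim_row (X $$ (p div 2, q div 2) \<cdot>\<^sub>m Y)"
      "j < dim_col (X $$ (p div 2, q div 2) \<cdot>\<^sub>m Y)"
    then have ij: "i < 2" "j < 2" using assms(3) by auto
    have "p div 2 < 2" "q div 2 < 2" using that by auto
    then have lt: "2 * (p div 2) + i < 4" "2 * (q div 2) + j < 4" using ij by linarith+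
    show "mat 2 2 (\<lambda>(i, j). tensor_mat X Y $$ (2 * (p div 2) + i, 2 * (q div 2) + j)) $$ (i, j)
      = (X $$ (p div 2, q div 2) \<cdot>\<^sub>m Y) $$ (i, j)"
      using ij lt assms(2,3) by (simp add: tensor_mat_def)
  qed (use assms(3) in auto)
  show ?thesis
  proof (rule eq_matI)
    fix p q assume "p < dim_row (tensor_mat X (E Y))" "q < dim_col (tensor_mat X (E Y))"
    then have pq: "p < 4" "q < 4" using assms EY by (auto simp: tensor_mat_def)
    have "E (X $$ (p div 2, q div 2) \<cdot>\<^sub>m Y) = X $$ (p div 2, q div 2) \<cdot>\<^sub>m E Y"
      using assms unfolding qubit_linear_def by blast
    then show "id_tensor E (tensor_mat X Y) $$ (p, q) = tensor_mat X (E Y) $$ (p, q)"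
      using pq assms EY by (simp add: id_tensor_def blk) (simp add: tensor_mat_def)
  qed (use assms EY in \<open>auto simp: id_tensor_def tensor_mat_def\<close>)
qed


section \<open>Pauli channels\<close>

definition is_pauli_channel :: "(complex mat \<Rightarrow> complex mat) \<Rightarrow> bool" where
  "is_pauli_channel E \<longleftrightarrow>
     (\<exists>\<alpha> \<beta> \<gamma> \<delta> :: real. 0 \<le> \<alpha> \<and> 0 \<le> \<beta> \<and> 0 \<le> \<gamma> \<and> 0 \<le> \<delta> \<and> \<alpha> + \<beta> + \<gamma> + \<delta> = 1 \<and>
       (\<forall>\<rho> \<in> carrier_mat 2 2.
          E \<rho> = complex_of_real \<alpha> \<cdot>\<^sub>m \<rho>
              + complex_of_real \<beta> \<cdot>\<^sub>m (pauli_x * \<rho> * pauli_x)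
              + complex_of_real \<gamma> \<cdot>\<^sub>m (pauli_y * \<rho> * pauli_y)
              + complex_of_real \<delta> \<cdot>\<^sub>m (pauli_z * \<rho> * pauli_z)))"


section \<open>The SGAD channel\<close>

text \<open>The thermal photon number \<open>Nth\<close> is itself the parameter, ranging over all
  non-negative reals; temperature, frequency and physical constants enter only through it.
  The arguments are \<open>g\<close> (spontaneous emission rate), \<open>Nth\<close>, the squeezing parameters
  \<open>r\<close> and \<open>\<Phi>\<close>, and the time \<open>t\<close>.\<close>

definition sgad_N :: "real \<Rightarrow> real \<Rightarrow> real" where
  "sgad_N Nth r = Nth * ((cosh r)\<^sup>2 + (sinh r)\<^sup>2) + (sinh r)\<^sup>2"

definition sgad_a :: "real \<Rightarrow> real \<Rightarrow> real" where
  "sgad_a Nth r = sinh (2 * r) * (2 * Nth + 1)"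

definition sgad_A :: "real \<Rightarrow> real \<Rightarrow> real \<Rightarrow> real \<Rightarrow> real \<Rightarrow> real" where
  "sgad_A g Nth r \<Phi> t =
     (1 + 1/2 * (exp (g * sgad_a Nth r * t) - 1) * (1 + cos \<Phi>))
       * exp (- g * (2 * sgad_N Nth r + 1 + sgad_a Nth r) * t / 2)"

definition sgad_G :: "real \<Rightarrow> real \<Rightarrow> real \<Rightarrow> real \<Rightarrow> real \<Rightarrow> real" where
  "sgad_G g Nth r \<Phi> t =
     (1 + 1/2 * (exp (g * sgad_a Nth r * t) - 1) * (1 - cos \<Phi>))
       * exp (- g * (2 * sgad_N Nth r + 1 + sgad_a Nth r) * t / 2)"

definition sgad_B :: "real \<Rightarrow> real \<Rightarrow> real \<Rightarrow> real \<Rightarrow> real \<Rightarrow> real" where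
  "sgad_B g Nth r \<Phi> t =
     sin \<Phi> * sinh (g * sgad_a Nth r * t / 2) * exp (- g * (2 * sgad_N Nth r + 1) * t / 2)"

definition sgad_H :: "real \<Rightarrow> real \<Rightarrow> real \<Rightarrow> real \<Rightarrow> real" where
  "sgad_H g Nth r t = exp (- g * (2 * sgad_N Nth r + 1) * t)"

definition sgad_Y :: "real \<Rightarrow> real \<Rightarrow> real \<Rightarrow> real \<Rightarrow> real" where
  "sgad_Y g Nth r t = (1 - sgad_H g Nth r t) / (2 * sgad_N Nth r + 1)"

definition is_sgad_channel ::
    "real \<Rightarrow> real \<Rightarrow> real \<Rightarrow> real \<Rightarrow> real \<Rightarrow> (complex mat \<Rightarrow> complex mat) \<Rightarrow> bool" where
  "is_sgad_channel g Nth r \<Phi> t E \<longleftrightarrow>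
     qubit_linear E \<and>
     E (1\<^sub>m 2) = 1\<^sub>m 2 - complex_of_real (sgad_Y g Nth r t) \<cdot>\<^sub>m pauli_z \<and>
     E pauli_x = complex_of_real (sgad_A g Nth r \<Phi> t) \<cdot>\<^sub>m pauli_x
               - complex_of_real (sgad_B g Nth r \<Phi> t) \<cdot>\<^sub>m pauli_y \<and>
     E pauli_y = - (complex_of_real (sgad_B g Nth r \<Phi> t) \<cdot>\<^sub>m pauli_x)
               + complex_of_real (sgad_G g Nth r \<Phi> t) \<cdot>\<^sub>m pauli_y \<and>
     E pauli_z = complex_of_real (sgad_H g Nth r t) \<cdot>\<^sub>m pauli_z"

lemma mat2_carrier: "mat_of_rows_list 2 [u, v] \<in> carrier_mat 2 2"
  by (rule carrier_matI) (simp_all add: mat_of_rows_list_def)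

lemma mat2_eqI:
  assumes "X \<in> carrier_mat 2 2" "Y \<in> carrier_mat 2 2"
    "X $$ (0, 0) = Y $$ (0, 0)" "X $$ (0, 1) = Y $$ (0, 1)"
    "X $$ (1, 0) = Y $$ (1, 0)" "X $$ (1, 1) = Y $$ (1, 1)"
  shows "X = Y"
  using assms by (intro eq_matI) (auto simp: less_2_cases_iff)

lemma sgad_channel_exists: "\<exists>E. is_sgad_channel g Nth r \<Phi> t E"
proof -
  define y where "y = complex_of_real (sgad_Y g Nth r t)"
  define a where "a = complex_of_real (sgad_A g Nth r \<Phi> t)"
  define b where "b = complex_of_real (sgad_B g Nth r \<Phi> t)"
  define h where "h = complex_of_real (sgad_H g Nth r t)"
  define c where "c = complex_of_real (sgad_G g Nth r \<Phi> t)"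
  define c1 cx cy cz :: "complex mat \<Rightarrow> complex" where
    "c1 = (\<lambda>X. (X $$ (0,0) + X $$ (1,1)) / 2)" and
    "cx = (\<lambda>X. (X $$ (0,1) + X $$ (1,0)) / 2)" and
    "cy = (\<lambda>X. \<i> * (X $$ (0,1) - X $$ (1,0)) / 2)" and
    "cz = (\<lambda>X. (X $$ (0,0) - X $$ (1,1)) / 2)"
  define E where "E = (\<lambda>X. mat_of_rows_list 2
     [[c1 X * (1 - y) + cz X * h,
       (cx X * a - cy X * b) - \<i> * (cy X * c - cx X * b)],
      [(cx X * a - cy X * b) + \<i> * (cy X * c - cx X * b),
       c1 X * (1 + y) - cz X * h]])"
  have pauli: "pauli_x $$ (0,0) = 0" "pauli_x $$ (0,1) = 1" "pauli_x $$ (1,0) = 1"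
    "pauli_x $$ (1,1) = 0" "pauli_y $$ (0,0) = 0" "pauli_y $$ (0,1) = - \<i>"
    "pauli_y $$ (1,0) = \<i>" "pauli_y $$ (1,1) = 0" "pauli_z $$ (0,0) = 1"
    "pauli_z $$ (0,1) = 0" "pauli_z $$ (1,0) = 0" "pauli_z $$ (1,1) = - 1"
    by (simp_all add: pauli_x_def pauli_y_def pauli_z_def mat_of_rows_list_def)
  have carr: "E X \<in> carrier_mat 2 2" "pauli_x \<in> carrier_mat 2 2" "pauli_y \<in> carrier_mat 2 2"
    "pauli_z \<in> carrier_mat 2 2" for X
    unfolding E_def pauli_x_def pauli_y_def pauli_z_def by (rule mat2_carrier)+
  note dims = carrier_matD[OF carr(1)] carrier_matD[OF carr(2)] carrier_matD[OF carr(3)]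
    carrier_matD[OF carr(4)]
  have ent: "E X $$ (0,0) = c1 X * (1 - y) + cz X * h"
    "E X $$ (0,1) = (cx X * a - cy X * b) - \<i> * (cy X * c - cx X * b)"
    "E X $$ (1,0) = (cx X * a - cy X * b) + \<i> * (cy X * c - cx X * b)"
    "E X $$ (1,1) = c1 X * (1 + y) - cz X * h" for X
    by (simp_all add: E_def mat_of_rows_list_def)
  have add: "c1 (X + Z) = c1 X + c1 Z" "cx (X + Z) = cx X + cx Z" "cy (X + Z) = cy X + cy Z"
    "cz (X + Z) = cz X + cz Z" if "X \<in> carrier_mat 2 2" "Z \<in> carrier_mat 2 2" for X Z
    using that
    by (simp_all add: c1_def cx_def cy_def cz_def carrier_matD add_divide_distrib
        diff_divide_distrib distrib_left right_diff_distrib)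
  have smult: "c1 (k \<cdot>\<^sub>m X) = k * c1 X" "cx (k \<cdot>\<^sub>m X) = k * cx X" "cy (k \<cdot>\<^sub>m X) = k * cy X"
    "cz (k \<cdot>\<^sub>m X) = k * cz X" if "X \<in> carrier_mat 2 2" for k X
    using that
    by (simp_all add: c1_def cx_def cy_def cz_def carrier_matD add_divide_distrib
        diff_divide_distrib distrib_left right_diff_distrib mult.left_commute)
  have basis: "c1 (1\<^sub>m 2) = 1" "cx (1\<^sub>m 2) = 0" "cy (1\<^sub>m 2) = 0" "cz (1\<^sub>m 2) = 0"
    "c1 pauli_x = 0" "cx pauli_x = 1" "cy pauli_x = 0" "cz pauli_x = 0"
    "c1 pauli_y = 0" "cx pauli_y = 0" "cy pauli_y = 1" "cz pauli_y = 0"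
    "c1 pauli_z = 0" "cx pauli_z = 0" "cy pauli_z = 0" "cz pauli_z = 1"
    by (simp_all add: c1_def cx_def cy_def cz_def pauli[unfolded One_nat_def])
  have "E (X + Z) = E X + E Z" if "X \<in> carrier_mat 2 2" "Z \<in> carrier_mat 2 2" for X Z
    by (rule mat2_eqI)
       (use that in \<open>simp_all add: carr dims ent[unfolded One_nat_def] add algebra_simps\<close>)
  moreover have "E (k \<cdot>\<^sub>m X) = k \<cdot>\<^sub>m E X" if "X \<in> carrier_mat 2 2" for k X
    by (rule mat2_eqI)
       (use that in \<open>simp_all add: carr dims ent[unfolded One_nat_def] smult algebra_simps\<close>)
  ultimately have "qubit_linear E"
    unfolding qubit_linear_def using carr(1) by blast
  moreover have "E (1\<^sub>m 2) = 1\<^sub>m 2 - y \<cdot>\<^sub>m pauli_z" "E pauli_x = a \<cdot>\<^sub>m pauli_x - b \<cdot>\<^sub>m pauli_y"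
    "E pauli_y = - (b \<cdot>\<^sub>m pauli_x) + c \<cdot>\<^sub>m pauli_y" "E pauli_z = h \<cdot>\<^sub>m pauli_z"
    by - (rule mat2_eqI; simp add: carr dims ent[unfolded One_nat_def] basis
        pauli[unfolded One_nat_def] minus_carrier_mat)+
  ultimately show ?thesis
    unfolding is_sgad_channel_def y_def a_def b_def c_def h_def by blast
qed

end

(* The Choi matrix splits into an outer 2 x 2 block (indices 0, 3) and an inner one (indices 1, 2),
   whose eigenvalues are f_+, f_- and e_+, e_-. Put M = 2N + 1 = (2 Nth + 1) cosh 2r, so that
   M^2 - a^2 = (2 Nth + 1)^2, and let w = g t M / 2, u = g t a / 2. The difference A - G together
   with B gives (A - G)^2 + 4 B^2 = 4 H sinh^2 u, while (A + G)^2 = 4 H cosh^2 u and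
   (1 - H)^2 = 4 H sinh^2 w. Hence both blocks have the same determinant,
   H (sinh^2 w (1 - 1/M^2) - sinh^2 u). Since sinh x / x is increasing and a^2 <= M^2 - 1,
   it is positive unless M = 1, that is, Nth = r = 0. *)

theory Submission
  imports Defs
begin

section \<open>X-shaped matrices\<close>

text \<open>Up to a permutation of the basis this is block diagonal: the outer block
  \<open>a b c d\<close> lives on the indices 0 and 3, the inner block \<open>p q r s\<close> on 1
  and 2. The entry type stays general so that the determinant formula also applies over a polynomial
  ring.\<close>

definition x_mat :: "'a::zero \<Rightarrow> 'a \<Rightarrow> 'a \<Rightarrow> 'a \<Rightarrow> 'a \<Rightarrow> 'a \<Rightarrow> 'a \<Rightarrow> 'a \<Rightarrow> 'a mat" where
  "x_mat a b c d p q r s =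
     mat_of_rows_list 4 [[a, 0, 0, b], [0, p, q, 0], [0, r, s, 0], [c, 0, 0, d]]"

lemma x_mat_carrier [simp]: "x_mat a b c d p q r s \<in> carrier_mat 4 4"
  by (simp add: x_mat_def mat_of_rows_list_def carrier_matI)

lemma x_mat_dim [simp]:
  "dim_row (x_mat a b c d p q r s) = 4" "dim_col (x_mat a b c d p q r s) = 4"
  using x_mat_carrier by blast+

lemma less_4_cases: "(i::nat) < 4 \<longleftrightarrow> i = 0 \<or> i = 1 \<or> i = 2 \<or> i = 3"
  by auto

lemma mat4_eqI:
  assumes "M \<in> carrier_mat 4 4" "M' \<in> carrier_mat 4 4"
    and "\<And>i j. i \<in> {0,1,2,3} \<Longrightarrow> j \<in> {0,1,2,3} \<Longrightarrow> M $$ (i, j) = M' $$ (i, j)"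
  shows "M = M'"
  using assms by (intro eq_matI) (simp_all add: less_4_cases)

lemma x_mat_index:
  "x_mat a b c d p q r s $$ (i, j) =
     [[a, 0, 0, b], [0, p, q, 0], [0, r, s, 0], [c, 0, 0, d]] ! i ! j" if "i < 4" "j < 4"
  using that by (simp add: x_mat_def mat_of_rows_list_def)

lemma x_mat_add:
  "x_mat a b c d p q r s + x_mat a' b' c' d' p' q' r' s' =
   x_mat (a + a') (b + b') (c + c') (d + d') (p + p') (q + q') (r + r') (s + s' :: 'a :: monoid_add)"
  by (rule mat4_eqI) (auto simp: x_mat_index)

section \<open>Determinant, characteristic polynomial and eigenvalues\<close>

lemma det_mat_2:
  assumes "A \<in> carrier_mat 2 2"
  shows "det A = A $$ (0,0) * A $$ (1,1) - A $$ (0,1) * A $$ (1,0)"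
proof -
  have "det A = (\<Sum>i<2. A $$ (i,0) * cofactor A i 0)"
    by (rule laplace_expansion_column[OF assms]) simp
  also have "\<dots> = A $$ (0,0) * A $$ (1,1) - A $$ (0,1) * A $$ (1,0)"
    using assms
    by (simp add: numeral_2_eq_2 cofactor_def det_single mat_delete_def)
  finally show ?thesis .
qed

lemma det_mat_3:
  assumes "A \<in> carrier_mat 3 3"
  shows "det A = A $$ (0,0) * (A $$ (1,1) * A $$ (2,2) - A $$ (1,2) * A $$ (2,1))
    - A $$ (1,0) * (A $$ (0,1) * A $$ (2,2) - A $$ (0,2) * A $$ (2,1))
    + A $$ (2,0) * (A $$ (0,1) * A $$ (1,2) - A $$ (0,2) * A $$ (1,1))"
proof -
  have c: "mat_delete A i 0 \<in> carrier_mat 2 2" for i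
    using assms by (auto simp: mat_delete_def)
  have "det A = (\<Sum>i<3. A $$ (i,0) * cofactor A i 0)"
    by (rule laplace_expansion_column[OF assms]) simp
  also have "\<dots> = A $$ (0,0) * cofactor A 0 0 + A $$ (1,0) * cofactor A 1 0 + A $$ (2,0) * cofactor A 2 0"
    by (simp add: eval_nat_numeral)
  finally show ?thesis
    using assms
    by (simp add: cofactor_def det_mat_2[OF c]) (simp add: mat_delete_def eval_nat_numeral algebra_simps)
qed

text \<open>In the expansion along column 0 only rows 0 and 3 contribute, and each of the two minors
  contains the inner block, whose determinant factors out.\<close>

lemma det_x_mat: "det (x_mat a b c d p q r s) = (a * d - b * c) * (p * s - q * r)"
  for a :: "'a::comm_ring_1"
proof -
  let ?A = "x_mat a b c d p q r s"
  have c: "mat_delete ?A i 0 \<in> carrier_mat 3 3" for i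
    by (auto simp: mat_delete_def)
  have "det ?A = (\<Sum>i<4. ?A $$ (i,0) * cofactor ?A i 0)"
    by (rule laplace_expansion_column[OF x_mat_carrier]) simp
  also have "\<dots> = a * cofactor ?A 0 0 + c * cofactor ?A 3 0"
    by (simp add: eval_nat_numeral x_mat_index)
  also have "cofactor ?A 0 0 = d * (p * s - q * r)"
    by (simp add: cofactor_def det_mat_3[OF c]) (simp add: mat_delete_def x_mat_index algebra_simps)
  also have "cofactor ?A 3 0 = - b * (p * s - q * r)"
    by (simp add: cofactor_def det_mat_3[OF c]) (simp add: mat_delete_def x_mat_index algebra_simps)
  finally show ?thesis by (simp add: algebra_simps)
qed

text \<open>The characteristic matrix is itself x-shaped, so \<open>det_x_mat\<close> over the
  polynomial ring yields one quadratic per block.\<close>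

lemma char_poly_x_mat:
  "char_poly (x_mat a b c d p q r s) =
     [:a * d - b * c, - (a + d), 1:] * [:p * s - q * r, - (p + s), 1:]"
  for a :: "'a::comm_ring_1"
proof -
  have "char_poly_matrix (x_mat a b c d p q r s) =
      x_mat [:-a, 1:] [:-b:] [:-c:] [:-d, 1:] [:-p, 1:] [:-q:] [:-r:] [:-s, 1:]"
    by (rule mat4_eqI) (auto simp: char_poly_matrix_def x_mat_index)
  then show ?thesis
    by (simp add: char_poly_def det_x_mat algebra_simps)
qed

lemma eigenvalues_if_char_poly_splits:
  assumes "A \<in> carrier_mat n n" "char_poly A = (\<Prod>x\<leftarrow>xs. [:- x, 1:])"
  shows "{x. eigenvalue A x} = set (xs :: 'a :: field list)"
  using assms by (auto simp: eigenvalue_root_char_poly poly_prod_list prod_list_zero_iff)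

section \<open>Rank of x-shaped matrices\<close>

text \<open>The rank of the 2 x 2 matrix with rows \<open>(a, b)\<close> and \<open>(c, d)\<close>.\<close>

definition rank2 :: "'a::comm_ring_1 \<Rightarrow> 'a \<Rightarrow> 'a \<Rightarrow> 'a \<Rightarrow> nat" where
  "rank2 a b c d = (if a * d \<noteq> b * c then 2 else if a = 0 \<and> b = 0 \<and> c = 0 \<and> d = 0 then 0 else 1)"

lemma singular_2_factor:
  fixes a b c d :: "'a::field"
  assumes "a * d = b * c"
  obtains u v u' v' where "a = u * u'" "b = u * v'" "c = v * u'" "d = v * v'"
proof (cases "a = 0 \<and> b = 0")
  case True
  then show ?thesis using that[of 0 c 1 d]
    by (metis mult_1_right mult_zero_left that mult_1_left)
next
  case False
  then consider "a \<noteq> 0" | "b \<noteq> 0" by auto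
  then show ?thesis
  proof cases
    case 1
    \<comment> \<open>The row factor (u', v') is the first row (a, b). The column factor (u, v) is
      (1, c / a), or (1, d / b) in the other case.\<close>
    then show ?thesis using that[of 1 a b "c / a"] assms by (simp add: field_simps)
  next
    case 2
    then show ?thesis using that[of 1 a b "d / b"] assms by (simp add: field_simps)
  qed
qed

text \<open>A singular block is a column times a row; padding both with zeros at indices 1 and 2
  makes the whole 4 x 4 matrix such a product.\<close>

lemma rank_outer_le_1:
  fixes a b c d :: "'a::field"
  assumes "a * d = b * c"
  shows "vec_space.rank 4 (x_mat a b c d 0 0 0 0) \<le> 1"
proof -
  obtain u v u' v' where "a = u * u'" "b = u * v'" "c = v * u'" "d = v * v'"
    using singular_2_factor[OF assms] .
  then show ?thesis
    by (intro vec_space.rank_le_1_product_entries[where f = "\<lambda>i. [u, 0, 0, v] ! i" and g = "\<lambda>j. [u', 0, 0, v'] ! j"])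
      (auto simp: x_mat_index less_4_cases)
qed

lemma rank_inner_le_1:
  fixes p q r s :: "'a::field"
  assumes "p * s = q * r"
  shows "vec_space.rank 4 (x_mat 0 0 0 0 p q r s) \<le> 1"
proof -
  obtain u v u' v' where "p = u * u'" "q = u * v'" "r = v * u'" "s = v * v'"
    using singular_2_factor[OF assms] .
  then show ?thesis
    by (intro vec_space.rank_le_1_product_entries[where f = "\<lambda>i. [0, u, v, 0] ! i" and g = "\<lambda>j. [0, u', v', 0] ! j"])
      (auto simp: x_mat_index less_4_cases)
qed

lemma rank_x_mat_add:
  "vec_space.rank 4 (x_mat (a + a') (b + b') (c + c') (d + d') (p + p') (q + q') (r + r') (s + s' :: 'a :: field))
    \<le> vec_space.rank 4 (x_mat a b c d p q r s) + vec_space.rank 4 (x_mat a' b' c' d' p' q' r' s')"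
  unfolding x_mat_add[symmetric] by (intro vec_space.rank_subadditive) auto

text \<open>For an invertible block the bound 2 comes from splitting it into its two rows, each of
  which forms a singular block.\<close>

lemma rank_outer_le:
  "vec_space.rank 4 (x_mat a b c d 0 0 0 (0 :: 'a :: field)) \<le> rank2 a b c d"
proof (cases "a * d = b * c")
  case True
  show ?thesis
  proof (cases "a = 0 \<and> b = 0 \<and> c = 0 \<and> d = 0")
    case z: True
    have "x_mat 0 0 0 0 0 0 0 0 = (0\<^sub>m 4 4 :: 'a mat)"
      by (rule mat4_eqI) (auto simp: x_mat_index)
    then show ?thesis using z vec_space.rank_0I[of 4 4, where 'a = 'a] by simp
  next
    case False
    then show ?thesis using rank_outer_le_1[OF True] True by (auto simp: rank2_def)
  qed
next
  case False
  have "vec_space.rank 4 (x_mat a b c d 0 0 0 0) \<le>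
      vec_space.rank 4 (x_mat a b 0 0 0 0 0 0) + vec_space.rank 4 (x_mat 0 0 c d 0 0 0 0)"
    using rank_x_mat_add[of a 0 b 0 0 c 0 d 0 0 0 0 0 0 0 0] by simp
  also have "\<dots> \<le> 2"
    using rank_outer_le_1[of a 0 b 0] rank_outer_le_1[of 0 d 0 c] by simp
  finally show ?thesis using False by (simp add: rank2_def)
qed

lemma rank_inner_le:
  "vec_space.rank 4 (x_mat 0 0 0 0 p q r (s :: 'a :: field)) \<le> rank2 p q r s"
proof (cases "p * s = q * r")
  case True
  show ?thesis
  proof (cases "p = 0 \<and> q = 0 \<and> r = 0 \<and> s = 0")
    case z: True
    have "x_mat 0 0 0 0 0 0 0 0 = (0\<^sub>m 4 4 :: 'a mat)"
      by (rule mat4_eqI) (auto simp: x_mat_index)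
    then show ?thesis using z vec_space.rank_0I[of 4 4, where 'a = 'a] by simp
  next
    case False
    then show ?thesis using rank_inner_le_1[OF True] True by (auto simp: rank2_def)
  qed
next
  case False
  have "vec_space.rank 4 (x_mat 0 0 0 0 p q r s) \<le>
      vec_space.rank 4 (x_mat 0 0 0 0 p q 0 0) + vec_space.rank 4 (x_mat 0 0 0 0 0 0 r s)"
    using rank_x_mat_add[of 0 0 0 0 0 0 0 0 p 0 q 0 0 r 0 s] by simp
  also have "\<dots> \<le> 2"
    using rank_inner_le_1[of p 0 q 0] rank_inner_le_1[of 0 s 0 r] by simp
  finally show ?thesis using False by (simp add: rank2_def)
qed

lemma rank_x_mat_le: "vec_space.rank 4 (x_mat a b c d p q r (s :: 'a :: field)) \<le> rank2 a b c d + rank2 p q r s"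
  using rank_x_mat_add[of a 0 b 0 c 0 d 0 0 p 0 q 0 r 0 s]
    rank_outer_le[of a b c d] rank_inner_le[of p q r s] by simp

text \<open>If a singular block has a nonzero entry, adding 1 at the diagonally opposite position
  changes the determinant by plus or minus that entry, so a matrix of rank 1 suffices. The zero
  block is completed by the identity, an invertible block by zero.\<close>

lemma rank2_completion:
  fixes a b c d :: "'a::field"
  obtains a' b' c' d' where "(a + a') * (d + d') \<noteq> (b + b') * (c + c')"
    "rank2 a b c d + rank2 a' b' c' d' = 2"
proof -
  consider "a * d \<noteq> b * c" | "a = 0" "b = 0" "c = 0" "d = 0" | "a * d = b * c" "a \<noteq> 0"
    | "a * d = b * c" "b \<noteq> 0" | "a * d = b * c" "c \<noteq> 0" | "a * d = b * c" "d \<noteq> 0" by blast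
  then show ?thesis
  proof cases
    case 1 then show ?thesis using that[of 0 0 0 0] by (simp add: rank2_def)
  next
    case 2 then show ?thesis using that[of 1 1 0 0] by (simp add: rank2_def)
  next
    case 3 then show ?thesis using that[of 0 1 0 0] by (simp add: rank2_def algebra_simps)
  next
    case 4 then show ?thesis using that[of 0 0 0 1] by (simp add: rank2_def algebra_simps)
  next
    case 5 then show ?thesis using that[of 0 0 1 0] by (simp add: rank2_def algebra_simps)
  next
    case 6 then show ?thesis using that[of 1 0 0 0] by (simp add: rank2_def algebra_simps)
  qed
qed

text \<open>Lower bound: complete both blocks to invertible ones by adding an x-shaped matrix of the
  complementary rank, and use subadditivity.\<close>

lemma rank_x_mat:
  "vec_space.rank 4 (x_mat a b c d p q r (s :: 'a :: field)) = rank2 a b c d + rank2 p q r s"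
proof (rule antisym[OF rank_x_mat_le])
  obtain a' d' b' c' where o: "(a + a') * (d + d') \<noteq> (b + b') * (c + c')"
    "rank2 a b c d + rank2 a' b' c' d' = 2"
    using rank2_completion[of a d b c] by metis
  obtain p' s' q' r' where i: "(p + p') * (s + s') \<noteq> (q + q') * (r + r')"
    "rank2 p q r s + rank2 p' q' r' s' = 2"
    using rank2_completion[of p s q r] by metis
  have "det (x_mat (a + a') (b + b') (c + c') (d + d') (p + p') (q + q') (r + r') (s + s')) \<noteq> 0"
    using o(1) i(1) by (simp add: det_x_mat)
  from vec_space.low_rank_det_zero[OF x_mat_carrier this]
  have "4 \<le> vec_space.rank 4 (x_mat a b c d p q r s)
      + vec_space.rank 4 (x_mat a' b' c' d' p' q' r' s')"
    using rank_x_mat_add[of a a' b b' c c' d d' p p' q q' r r' s s'] by simp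
  then show "rank2 a b c d + rank2 p q r s \<le> vec_space.rank 4 (x_mat a b c d p q r s)"
    using rank_x_mat_le[of a' b' c' d' p' q' r' s'] o(2) i(2) by linarith
qed

section \<open>Choi matrices of the two channel families\<close>

text \<open>\<open>bell_vec\<close> has entry 1 exactly at the indices 0 and 3, so block (k, l) of
  its ket-bra is the matrix unit at (k, l).\<close>

lemma choi_index:
  assumes "p < 4" "q < 4"
  shows "choi E $$ (p, q) =
    E (mat 2 2 (\<lambda>(i, j). if i = p div 2 \<and> j = q div 2 then 1 else 0)) $$ (p mod 2, q mod 2)"
proof -
  have b: "bell_vec $ (2 * k + i) = (if i = k then 1 else 0)" if "k < 2" "i < 2" for k i
    using that by (auto simp: bell_vec_def tensor_vec_def less_2_cases_iff)
  have d: "dim_vec bell_vec = 4" by (simp add: bell_vec_def tensor_vec_def)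
  have "mat 2 2 (\<lambda>(i, j). ket_bra bell_vec bell_vec $$ (2 * (p div 2) + i, 2 * (q div 2) + j))
    = mat 2 2 (\<lambda>(i, j). if i = p div 2 \<and> j = q div 2 then 1 else 0)"
  proof (rule eq_matI, goal_cases)
    case (1 i j)
    have "p div 2 < 2" "q div 2 < 2" using assms by auto
    moreover from this have "2 * (p div 2) + i < 4" "2 * (q div 2) + j < 4" using 1 by auto
    ultimately show ?case using 1 b[of "p div 2" i] b[of "q div 2" j]
      by (simp add: ket_bra_def d)
  qed auto
  then show ?thesis using assms by (simp add: choi_def id_tensor_def)
qed

text \<open>Each 2 x 2 block of the Choi matrix is the image of a matrix unit. A map that does not
  mix diagonal with off-diagonal entries therefore has an x-shaped Choi matrix; for example, the
  image of the unit at (0, 1) carries \<open>b\<close> and \<open>q\<close>, which explains the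
  order of the coefficients.\<close>

lemma choi_eq_x_mat:
  assumes "\<And>X. X \<in> carrier_mat 2 2 \<Longrightarrow> E X $$ (0,0) = a * X $$ (0,0) + s * X $$ (1,1)"
    "\<And>X. X \<in> carrier_mat 2 2 \<Longrightarrow> E X $$ (0,1) = b * X $$ (0,1) + r * X $$ (1,0)"
    "\<And>X. X \<in> carrier_mat 2 2 \<Longrightarrow> E X $$ (1,0) = q * X $$ (0,1) + c * X $$ (1,0)"
    "\<And>X. X \<in> carrier_mat 2 2 \<Longrightarrow> E X $$ (1,1) = p * X $$ (0,0) + d * X $$ (1,1)"
  shows "choi E = x_mat a b c d p q r s"
proof (rule mat4_eqI)
  show "choi E \<in> carrier_mat 4 4" by (simp add: choi_def id_tensor_def)
  fix i j :: nat assume ij: "i \<in> {0,1,2,3}" "j \<in> {0,1,2,3}"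
  then show "choi E $$ (i, j) = x_mat a b c d p q r s $$ (i, j)"
    by (elim insertE emptyE)
      (simp_all add: choi_index x_mat_index assms[unfolded One_nat_def])
qed simp

section \<open>Pauli matrices in coordinates, and the two Choi matrices\<close>

lemma pauli_carrier:
  "pauli_x \<in> carrier_mat 2 2" "pauli_y \<in> carrier_mat 2 2" "pauli_z \<in> carrier_mat 2 2"
  unfolding pauli_x_def pauli_y_def pauli_z_def by (rule mat2_carrier)+

lemma pauli_index:
  "pauli_x $$ (0,0) = 0" "pauli_x $$ (0,Suc 0) = 1" "pauli_x $$ (Suc 0,0) = 1"
  "pauli_x $$ (Suc 0,Suc 0) = 0" "pauli_y $$ (0,0) = 0" "pauli_y $$ (0,Suc 0) = - \<i>"
  "pauli_y $$ (Suc 0,0) = \<i>" "pauli_y $$ (Suc 0,Suc 0) = 0" "pauli_z $$ (0,0) = 1"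
  "pauli_z $$ (0,Suc 0) = 0" "pauli_z $$ (Suc 0,0) = 0" "pauli_z $$ (Suc 0,Suc 0) = - 1"
  by (simp_all add: pauli_x_def pauli_y_def pauli_z_def mat_of_rows_list_def)

lemma mult_mat_2_index:
  assumes "X \<in> carrier_mat 2 2" "Y \<in> carrier_mat 2 2" "i < 2" "j < 2"
  shows "(X * Y) $$ (i, j) = X $$ (i,0) * Y $$ (0,j) + X $$ (i,Suc 0) * Y $$ (Suc 0,j)"
  using assms by (simp add: scalar_prod_def numeral_2_eq_2)

lemma imaginary_unit_mult:
  "\<i> * (\<i> * z) = - z" "\<i> * (z * \<i>) = - z" "\<i> * z * \<i> = - z"
proof -
  show "\<i> * (\<i> * z) = - z" by (simp flip: mult.assoc)
  then show "\<i> * (z * \<i>) = - z" "\<i> * z * \<i> = - z" by (simp_all only: mult_ac)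
qed

lemma conj_mat_2_index:
  assumes "P \<in> carrier_mat 2 2" "X \<in> carrier_mat 2 2" "Q \<in> carrier_mat 2 2" "i < 2" "j < 2"
  shows "(P * X * Q) $$ (i, j) =
    (P $$ (i,0) * X $$ (0,0) + P $$ (i,Suc 0) * X $$ (Suc 0,0)) * Q $$ (0,j) +
    (P $$ (i,0) * X $$ (0,Suc 0) + P $$ (i,Suc 0) * X $$ (Suc 0,Suc 0)) * Q $$ (Suc 0,j)"
  using assms
  by (simp add: mult_mat_2_index[OF mult_carrier_mat[of P 2 2 X 2]] mult_mat_2_index[of P X]
      del: index_mult_mat(1) assoc_mult_mat)

lemma conj_pauli_index:
  assumes X: "X \<in> carrier_mat 2 2"
  shows "(pauli_x * X * pauli_x) $$ (0,0) = X $$ (Suc 0,Suc 0)"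
    "(pauli_x * X * pauli_x) $$ (0,Suc 0) = X $$ (Suc 0,0)"
    "(pauli_x * X * pauli_x) $$ (Suc 0,0) = X $$ (0,Suc 0)"
    "(pauli_x * X * pauli_x) $$ (Suc 0,Suc 0) = X $$ (0,0)"
    "(pauli_y * X * pauli_y) $$ (0,0) = X $$ (Suc 0,Suc 0)"
    "(pauli_y * X * pauli_y) $$ (0,Suc 0) = - X $$ (Suc 0,0)"
    "(pauli_y * X * pauli_y) $$ (Suc 0,0) = - X $$ (0,Suc 0)"
    "(pauli_y * X * pauli_y) $$ (Suc 0,Suc 0) = X $$ (0,0)"
    "(pauli_z * X * pauli_z) $$ (0,0) = X $$ (0,0)"
    "(pauli_z * X * pauli_z) $$ (0,Suc 0) = - X $$ (0,Suc 0)"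
    "(pauli_z * X * pauli_z) $$ (Suc 0,0) = - X $$ (Suc 0,0)"
    "(pauli_z * X * pauli_z) $$ (Suc 0,Suc 0) = X $$ (Suc 0,Suc 0)"
  using conj_mat_2_index[OF pauli_carrier(1) X pauli_carrier(1)]
    conj_mat_2_index[OF pauli_carrier(2) X pauli_carrier(2)]
    conj_mat_2_index[OF pauli_carrier(3) X pauli_carrier(3)]
  by (simp_all add: pauli_index imaginary_unit_mult del: index_mult_mat(1) assoc_mult_mat)

text \<open>The SGAD channel is given on the Pauli basis, whereas the Choi matrix needs its action
  on entries. The coefficients are half the traces of X against the basis elements.\<close>

lemma qubit_linear_pauli_expansion:
  assumes "qubit_linear E" and X: "X \<in> carrier_mat 2 2"
  shows "E X = ((X $$ (0,0) + X $$ (1,1)) / 2) \<cdot>\<^sub>m E (1\<^sub>m 2) + ((X $$ (0,1) + X $$ (1,0)) / 2) \<cdot>\<^sub>m E pauli_x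
     + ((\<i> * (X $$ (0,1) - X $$ (1,0))) / 2) \<cdot>\<^sub>m E pauli_y + ((X $$ (0,0) - X $$ (1,1)) / 2) \<cdot>\<^sub>m E pauli_z"
    (is "_ = ?c1 \<cdot>\<^sub>m _ + ?cx \<cdot>\<^sub>m _ + ?cy \<cdot>\<^sub>m _ + ?cz \<cdot>\<^sub>m _")
proof -
  have add: "E (U + V) = E U + E V" if "U \<in> carrier_mat 2 2" "V \<in> carrier_mat 2 2" for U V
    using assms(1) that unfolding qubit_linear_def by blast
  have smult: "E (k \<cdot>\<^sub>m U) = k \<cdot>\<^sub>m E U" if "U \<in> carrier_mat 2 2" for k U
    using assms(1) that unfolding qubit_linear_def by blast
  have "X = ?c1 \<cdot>\<^sub>m 1\<^sub>m 2 + ?cx \<cdot>\<^sub>m pauli_x + ?cy \<cdot>\<^sub>m pauli_y + ?cz \<cdot>\<^sub>m pauli_z"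
    by (rule mat2_eqI)
      (use X in \<open>simp_all add: pauli_carrier pauli_carrier[THEN carrier_matD(1)]
         pauli_carrier[THEN carrier_matD(2)] pauli_index field_simps\<close>)
  moreover have "E (?c1 \<cdot>\<^sub>m 1\<^sub>m 2 + ?cx \<cdot>\<^sub>m pauli_x + ?cy \<cdot>\<^sub>m pauli_y + ?cz \<cdot>\<^sub>m pauli_z) =
     ?c1 \<cdot>\<^sub>m E (1\<^sub>m 2) + ?cx \<cdot>\<^sub>m E pauli_x + ?cy \<cdot>\<^sub>m E pauli_y + ?cz \<cdot>\<^sub>m E pauli_z"
    by (simp add: add smult pauli_carrier)
  ultimately show ?thesis by metis
qed

text \<open>In the Pauli expansion the two contributions of \<open>B\<close> cancel in the outer
  block and add up in the inner one.\<close>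

lemma choi_sgad:
  assumes "is_sgad_channel g Nth r \<Phi> t E"
  defines "A \<equiv> complex_of_real (sgad_A g Nth r \<Phi> t)" and "G \<equiv> complex_of_real (sgad_G g Nth r \<Phi> t)"
    and "B \<equiv> complex_of_real (sgad_B g Nth r \<Phi> t)" and "H \<equiv> complex_of_real (sgad_H g Nth r t)"
    and "Y \<equiv> complex_of_real (sgad_Y g Nth r t)"
  shows "choi E = x_mat ((1 - Y + H) / 2) ((A + G) / 2) ((A + G) / 2) ((1 + Y + H) / 2)
     ((1 + Y - H) / 2) ((A - G - 2 * \<i> * B) / 2) ((A - G + 2 * \<i> * B) / 2) ((1 - Y - H) / 2)"
proof -
  have lin: "qubit_linear E" and
    E: "E (1\<^sub>m 2) = 1\<^sub>m 2 - Y \<cdot>\<^sub>m pauli_z" "E pauli_x = A \<cdot>\<^sub>m pauli_x - B \<cdot>\<^sub>m pauli_y"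
    "E pauli_y = - (B \<cdot>\<^sub>m pauli_x) + G \<cdot>\<^sub>m pauli_y" "E pauli_z = H \<cdot>\<^sub>m pauli_z"
    using assms(1) unfolding is_sgad_channel_def A_def G_def B_def H_def Y_def by blast+
  note EX = qubit_linear_pauli_expansion[OF lin, unfolded E]
  note simps = pauli_carrier[THEN carrier_matD(1)] pauli_carrier[THEN carrier_matD(2)] pauli_index
  show ?thesis
    by (rule choi_eq_x_mat; subst EX, assumption; simp add: simps; simp add: field_simps imaginary_unit_mult)
qed

text \<open>The identity and \<open>pauli_z\<close> feed only the outer block,
  \<open>pauli_x\<close> and \<open>pauli_y\<close> only the inner one. The block eigenvalues are
  twice the weights, so the rank counts the nonzero weights.\<close>

lemma choi_pauli:
  fixes \<alpha> \<beta> \<gamma> \<delta> :: real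
  shows "choi (\<lambda>\<rho>. complex_of_real \<alpha> \<cdot>\<^sub>m \<rho>
              + complex_of_real \<beta> \<cdot>\<^sub>m (pauli_x * \<rho> * pauli_x)
              + complex_of_real \<gamma> \<cdot>\<^sub>m (pauli_y * \<rho> * pauli_y)
              + complex_of_real \<delta> \<cdot>\<^sub>m (pauli_z * \<rho> * pauli_z)) =
    x_mat (of_real (\<alpha> + \<delta>)) (of_real (\<alpha> - \<delta>)) (of_real (\<alpha> - \<delta>)) (of_real (\<alpha> + \<delta>))
      (of_real (\<beta> + \<gamma>)) (of_real (\<beta> - \<gamma>)) (of_real (\<beta> - \<gamma>)) (of_real (\<beta> + \<gamma>))"
  by (rule choi_eq_x_mat)
    (simp_all add: pauli_carrier[THEN carrier_matD(1)] pauli_carrier[THEN carrier_matD(2)]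
      conj_pauli_index ring_distribs del: index_mult_mat(1) assoc_mult_mat)

section \<open>The SGAD parameters\<close>

text \<open>This is the growth of sinh x / x with denominators cleared. By the mean value theorem
  the slopes of sinh over [0, y] and [y, x] are values of cosh at two increasing positive
  points.\<close>

lemma sinh_div_self_strict_mono:
  fixes x y :: real
  assumes "0 < y" "y < x"
  shows "x * sinh y < y * sinh x"
proof -
  have d: "(sinh has_real_derivative cosh z) (at z)" for z :: real
    by (auto intro!: derivative_eq_intros)
  obtain z1 where z1: "0 < z1" "z1 < y" "sinh y - sinh 0 = (y - 0) * cosh z1"
    using MVT2[of 0 y sinh cosh] assms d by auto
  obtain z2 where z2: "y < z2" "z2 < x" "sinh x - sinh y = (x - y) * cosh z2"
    using MVT2[of y x sinh cosh] assms d by auto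
  have "cosh z1 < cosh z2"
    using z1 z2 by (intro cosh_real_strict_mono) auto
  then have "y * (x - y) * cosh z1 < y * (x - y) * cosh z2"
    using assms by simp
  moreover have "y * (x - y) * cosh z1 = (x - y) * sinh y"
    using z1(3) by simp
  moreover have "y * (x - y) * cosh z2 = y * (sinh x - sinh y)"
    using z2(3) by simp
  ultimately have "(x - y) * sinh y < y * (sinh x - sinh y)" by simp
  then show ?thesis by (simp add: algebra_simps)
qed

text \<open>The hypotheses force |a| < M, so the growth of sinh x / x bounds the left side strictly
  by a^2 sinh^2 (s M), and a^2 is at most M^2 - 1. The case a = 0 is separate because that growth
  lemma needs positive arguments.\<close>

lemma sinh_scaled_less:
  fixes M a s :: real
  assumes "s > 0" "M > 1" "a\<^sup>2 + 1 \<le> M\<^sup>2"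
  shows "M\<^sup>2 * (sinh (s * a))\<^sup>2 < (M\<^sup>2 - 1) * (sinh (s * M))\<^sup>2"
proof (cases "a = 0")
  case True
  then show ?thesis using assms by simp
next
  case False
  have "\<bar>a\<bar>\<^sup>2 < M\<^sup>2" using assms(3) by simp
  then have "\<bar>a\<bar> < M" by (rule power_less_imp_less_base) (use assms(2) in simp)
  then have "s * M * sinh (s * \<bar>a\<bar>) < s * \<bar>a\<bar> * sinh (s * M)"
    using False assms by (intro sinh_div_self_strict_mono) auto
  then have "M * sinh (s * \<bar>a\<bar>) < \<bar>a\<bar> * sinh (s * M)"
    using assms(1) by (simp add: mult.assoc)
  then have "(M * sinh (s * \<bar>a\<bar>))\<^sup>2 < (\<bar>a\<bar> * sinh (s * M))\<^sup>2"
    using assms by (intro power_strict_mono) auto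
  moreover have "(sinh (s * \<bar>a\<bar>))\<^sup>2 = (sinh (s * a))\<^sup>2"
    by (cases "a \<ge> 0") auto
  ultimately have "M\<^sup>2 * (sinh (s * a))\<^sup>2 < a\<^sup>2 * (sinh (s * M))\<^sup>2"
    by (simp add: power_mult_distrib)
  also have "\<dots> \<le> (M\<^sup>2 - 1) * (sinh (s * M))\<^sup>2"
    using assms(3) by (intro mult_right_mono) auto
  finally show ?thesis .
qed

section \<open>Hyperbolic closed forms of the channel parameters\<close>

lemma sgad_N_eq: "2 * sgad_N Nth r + 1 = (2 * Nth + 1) * cosh (2 * r)"
proof -
  have "cosh (2 * r) = 2 * (sinh r)\<^sup>2 + 1" "(cosh r)\<^sup>2 = (sinh r)\<^sup>2 + 1"
    using cosh_double[of r] cosh_square_eq[of r] by auto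
  then show ?thesis by (simp add: sgad_N_def algebra_simps)
qed

lemma sgad_N_square: "(2 * sgad_N Nth r + 1)\<^sup>2 = (sgad_a Nth r)\<^sup>2 + (2 * Nth + 1)\<^sup>2"
  unfolding sgad_N_eq sgad_a_def power_mult_distrib cosh_square_eq by (simp add: ring_distribs)

lemma exp_minus_one_sinh: "exp (2 * u) - 1 = 2 * sinh u * exp u" for u :: real
  by (simp add: sinh_def ring_distribs exp_add[symmetric])

lemma exp_plus_one_cosh: "exp (2 * u) + 1 = 2 * cosh u * exp u" for u :: real
  by (simp add: cosh_def ring_distribs exp_add[symmetric])

text \<open>With v and w as in the proof, A - G is 2 cos \<Phi> sinh v exp (-w) and 2 B is 2 sin
  \<Phi> sinh v exp (-w), so the angle disappears from the sum of squares. In A + G the cosines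
  cancel at once.\<close>

lemma sgad_off_diagonal:
  defines "u \<equiv> \<lambda>g Nth r t. g * sgad_a Nth r * t / 2"
  shows "(sgad_A g Nth r \<Phi> t - sgad_G g Nth r \<Phi> t)\<^sup>2 + 4 * (sgad_B g Nth r \<Phi> t)\<^sup>2
      = 4 * sgad_H g Nth r t * (sinh (u g Nth r t))\<^sup>2" (is ?minus)
    and "(sgad_A g Nth r \<Phi> t + sgad_G g Nth r \<Phi> t)\<^sup>2
      = 4 * sgad_H g Nth r t * (cosh (u g Nth r t))\<^sup>2" (is ?plus)
proof -
  define v where "v = u g Nth r t"
  define w where "w = g * (2 * sgad_N Nth r + 1) * t / 2"
  have *: "g * sgad_a Nth r * t = 2 * v"
    "- g * (2 * sgad_N Nth r + 1 + sgad_a Nth r) * t / 2 = - w - v"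
    "g * sgad_a Nth r * t / 2 = v" "- g * (2 * sgad_N Nth r + 1) * t / 2 = - w"
    "- g * (2 * sgad_N Nth r + 1) * t = (- w) + (- w)"
    by (simp_all add: v_def u_def w_def field_simps)
  have e: "exp v * exp (- w - v) = exp (- w)" by (simp add: exp_add[symmetric])
  have H: "sgad_H g Nth r t = (exp (- w))\<^sup>2"
    unfolding sgad_H_def * exp_add power2_eq_square ..
  have "sgad_A g Nth r \<Phi> t - sgad_G g Nth r \<Phi> t = cos \<Phi> * (exp (2 * v) - 1) * exp (- w - v)"
    unfolding sgad_A_def sgad_G_def * by (simp add: field_simps)
  also have "\<dots> = 2 * cos \<Phi> * sinh v * exp (- w)"
    unfolding exp_minus_one_sinh e[symmetric] by simp
  finally have m: "sgad_A g Nth r \<Phi> t - sgad_G g Nth r \<Phi> t = 2 * cos \<Phi> * sinh v * exp (- w)" .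
  have "sgad_A g Nth r \<Phi> t + sgad_G g Nth r \<Phi> t = (exp (2 * v) + 1) * exp (- w - v)"
    unfolding sgad_A_def sgad_G_def * by (simp add: field_simps)
  also have "\<dots> = 2 * cosh v * exp (- w)"
    unfolding exp_plus_one_cosh e[symmetric] by simp
  finally have p: "sgad_A g Nth r \<Phi> t + sgad_G g Nth r \<Phi> t = 2 * cosh v * exp (- w)" .
  have B: "sgad_B g Nth r \<Phi> t = sin \<Phi> * sinh v * exp (- w)"
    unfolding sgad_B_def *(3) *(4) ..
  have "(2 * cos \<Phi> * sinh v * exp (- w))\<^sup>2 + 4 * (sin \<Phi> * sinh v * exp (- w))\<^sup>2
    = 4 * (exp (- w))\<^sup>2 * (sinh v)\<^sup>2"
    by (simp add: power_mult_distrib sin_squared_eq algebra_simps)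
  then show ?minus
    unfolding m B H v_def[symmetric] by simp
  show ?plus
    unfolding p H v_def[symmetric] by (simp add: power_mult_distrib)
qed

text \<open>Factoring exp (-w) out of 1 - exp (-2 w) leaves 2 sinh w. The result shares the factor 4
  H with the off-diagonal terms.\<close>

lemma one_minus_sgad_H:
  "(1 - sgad_H g Nth r t)\<^sup>2 = 4 * sgad_H g Nth r t * (sinh (g * t / 2 * (2 * sgad_N Nth r + 1)))\<^sup>2"
proof -
  define w where "w = g * t / 2 * (2 * sgad_N Nth r + 1)"
  have H: "sgad_H g Nth r t = exp (- w) * exp (- w)"
    unfolding sgad_H_def exp_add[symmetric] w_def by (simp add: field_simps)
  have "1 - exp (- w) * exp (- w) = exp (- w) * (exp w - exp (- w))"
    by (simp add: right_diff_distrib exp_add[symmetric])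
  also have "\<dots> = 2 * exp (- w) * sinh w" by (simp add: sinh_def)
  finally show ?thesis unfolding H w_def[symmetric] by (simp add: power2_eq_square)
qed

lemma sgad_N_ge_1: "Nth \<ge> 0 \<Longrightarrow> 2 * sgad_N Nth r + 1 \<ge> 1"
  by (simp add: sgad_N_def)

text \<open>By \<open>sgad_N_square\<close>, the value 1 leaves no room for positive
  \<open>Nth\<close> or nonzero \<open>sgad_a\<close>; the latter then forces sinh (2 r) =
  0.\<close>

lemma sgad_N_eq_1_iff:
  assumes "Nth \<ge> 0"
  shows "2 * sgad_N Nth r + 1 = 1 \<longleftrightarrow> Nth = 0 \<and> r = 0"
proof
  assume "2 * sgad_N Nth r + 1 = 1"
  then have "(sgad_a Nth r)\<^sup>2 + (2 * Nth + 1)\<^sup>2 = 1"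
    using sgad_N_square[of Nth r] by simp
  moreover have "(2 * Nth + 1)\<^sup>2 = 1 + 4 * Nth + 4 * Nth\<^sup>2" by (simp add: power2_eq_square algebra_simps)
  ultimately have "Nth = 0" "sgad_a Nth r = 0"
    using assms by (auto simp: add_nonneg_eq_0_iff)
  then show "Nth = 0 \<and> r = 0" by (simp add: sgad_a_def)
qed (simp add: sgad_N_def)

lemma sgad_H_bounds:
  assumes "g > 0" "Nth \<ge> 0" "t > 0"
  shows "0 < sgad_H g Nth r t" "sgad_H g Nth r t < 1"
  using assms sgad_N_ge_1[of Nth r] by (auto simp: sgad_H_def mult_neg_pos)

lemma sgad_Y_nonneg:
  assumes "g > 0" "Nth \<ge> 0" "t > 0"
  shows "0 \<le> sgad_Y g Nth r t"
  using sgad_H_bounds[OF assms, of r] sgad_N_ge_1[of Nth r] assms by (simp add: sgad_Y_def)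

text \<open>Both (1 + H)^2 - (1 - H)^2 and the difference of the off-diagonal terms equal 4 H, the
  latter by cosh^2 - sinh^2 = 1.\<close>

lemma sgad_block_dets_eq:
  "(1 + sgad_H g Nth r t)\<^sup>2 - ((sgad_A g Nth r \<Phi> t + sgad_G g Nth r \<Phi> t)\<^sup>2 + (sgad_Y g Nth r t)\<^sup>2) =
   (1 - sgad_H g Nth r t)\<^sup>2 - ((sgad_A g Nth r \<Phi> t - sgad_G g Nth r \<Phi> t)\<^sup>2
     + 4 * (sgad_B g Nth r \<Phi> t)\<^sup>2 + (sgad_Y g Nth r t)\<^sup>2)"
  unfolding sgad_off_diagonal cosh_square_eq by (simp add: power2_eq_square algebra_simps)

lemma sgad_block_det_eq_0_iff:
  assumes g: "g > 0" and Nth: "Nth \<ge> 0" and t: "t > 0"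
  shows "(1 - sgad_H g Nth r t)\<^sup>2 - ((sgad_A g Nth r \<Phi> t - sgad_G g Nth r \<Phi> t)\<^sup>2
     + 4 * (sgad_B g Nth r \<Phi> t)\<^sup>2 + (sgad_Y g Nth r t)\<^sup>2) = 0 \<longleftrightarrow> Nth = 0 \<and> r = 0"
proof -
  define M where "M = 2 * sgad_N Nth r + 1"
  define H where "H = sgad_H g Nth r t"
  let ?u = "g * t / 2 * sgad_a Nth r" and ?w = "g * t / 2 * M"
  have M: "M \<ge> 1" "M = 1 \<longleftrightarrow> Nth = 0 \<and> r = 0"
    using sgad_N_ge_1[OF Nth] sgad_N_eq_1_iff[OF Nth] by (auto simp: M_def)
  have H: "H > 0" using sgad_H_bounds(1)[OF assms] by (simp add: H_def)
  have u: "g * sgad_a Nth r * t / 2 = ?u" by simp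
  have h: "(1 - H)\<^sup>2 = 4 * H * (sinh ?w)\<^sup>2"
    using one_minus_sgad_H by (simp add: H_def M_def)
  have "(sgad_Y g Nth r t)\<^sup>2 = 4 * H * (sinh ?w)\<^sup>2 / M\<^sup>2"
    unfolding h[symmetric] by (simp add: sgad_Y_def H_def M_def power_divide)
  \<comment> \<open>Multiplying by M^2 clears the denominator of Y^2 and exposes the expression
    treated in \<open>sinh_scaled_less\<close>.\<close>
  then have "M\<^sup>2 * ((1 - H)\<^sup>2 - ((sgad_A g Nth r \<Phi> t - sgad_G g Nth r \<Phi> t)\<^sup>2
     + 4 * (sgad_B g Nth r \<Phi> t)\<^sup>2 + (sgad_Y g Nth r t)\<^sup>2)) =
     4 * H * ((M\<^sup>2 - 1) * (sinh ?w)\<^sup>2 - M\<^sup>2 * (sinh ?u)\<^sup>2)" (is "_ * ?D = _ * ?D'")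
    unfolding sgad_off_diagonal h u H_def[symmetric] using M(1) by (simp add: field_simps)
  then have D: "?D = 0 \<longleftrightarrow> ?D' = 0"
    using M(1) H by (metis mult_eq_0_iff less_irrefl not_one_le_zero zero_eq_power2 zero_neq_numeral)
  have "?D' = 0 \<longleftrightarrow> M = 1"
  proof
    assume "M = 1"
    then have "sgad_a Nth r = 0" using M(2) by (simp add: sgad_a_def)
    with \<open>M = 1\<close> show "?D' = 0" by simp
  next
    assume z: "?D' = 0"
    show "M = 1"
    proof (rule ccontr)
      assume "M \<noteq> 1"
      then have "M > 1" using M(1) by simp
      moreover have "1 \<le> (2 * Nth + 1)\<^sup>2" using Nth by (simp add: one_le_power)
      then have "(sgad_a Nth r)\<^sup>2 + 1 \<le> M\<^sup>2"
        using sgad_N_square[of Nth r] by (simp add: M_def)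
      ultimately show False
        using sinh_scaled_less[of "g * t / 2" M "sgad_a Nth r"] g t z by simp
    qed
  qed
  then show ?thesis using D M(2) by (simp add: H_def)
qed

section \<open>Spectrum and rank\<close>

text \<open>A block with trace x and determinant (x^2 - S) / 4 has discriminant S, so its
  eigenvalues are real when S is nonnegative.\<close>

lemma quadratic_roots:
  fixes x S :: real
  assumes "S \<ge> 0"
  shows "[:complex_of_real ((x\<^sup>2 - S) / 4), - complex_of_real x, 1:] =
    [:- complex_of_real (1/2 * (x + sqrt S)), 1:] * [:- complex_of_real (1/2 * (x - sqrt S)), 1:]"
proof -
  have "(x\<^sup>2 - S) / 4 = (1/2 * (x + sqrt S)) * (1/2 * (x - sqrt S))"
    using assms by (simp add: field_simps power2_eq_square)
  moreover have "x = 1/2 * (x + sqrt S) + 1/2 * (x - sqrt S)" by (simp add: field_simps)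
  moreover have "[:- e, 1:] * [:- f, 1:] = [:e * f, - (e + f), 1:]" for e f :: complex
    by simp
  ultimately show ?thesis by (metis of_real_mult of_real_add)
qed

lemma choi_sgad_spectrum_rank:
  assumes "g > 0" "Nth \<ge> 0" "t > 0" "is_sgad_channel g Nth r \<Phi> t E"
  defines "A \<equiv> sgad_A g Nth r \<Phi> t" and "G \<equiv> sgad_G g Nth r \<Phi> t" and "B \<equiv> sgad_B g Nth r \<Phi> t"
    and "H \<equiv> sgad_H g Nth r t" and "Y \<equiv> sgad_Y g Nth r t"
  defines "e_plus \<equiv> 1/2 * (1 - H + sqrt ((A - G)\<^sup>2 + 4 * B\<^sup>2 + Y\<^sup>2))"
    and "e_minus \<equiv> 1/2 * (1 - H - sqrt ((A - G)\<^sup>2 + 4 * B\<^sup>2 + Y\<^sup>2))"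
    and "f_plus \<equiv> 1/2 * (1 + H + sqrt ((A + G)\<^sup>2 + Y\<^sup>2))"
    and "f_minus \<equiv> 1/2 * (1 + H - sqrt ((A + G)\<^sup>2 + Y\<^sup>2))"
  shows "{x. eigenvalue (choi E) x} = complex_of_real ` {e_plus, e_minus, f_plus, f_minus}"
    and "char_poly (choi E) =
      (\<Prod>x\<leftarrow>[e_plus, e_minus, f_plus, f_minus]. [:- complex_of_real x, 1:])"
    and "e_minus = 0 \<longleftrightarrow> Nth = 0 \<and> r = 0"
    and "f_minus = 0 \<longleftrightarrow> Nth = 0 \<and> r = 0"
    and "vec_space.rank 4 (choi E) = (if Nth = 0 \<and> r = 0 then 2 else 4)"
proof -
  note defs = A_def[symmetric] G_def[symmetric] B_def[symmetric] H_def[symmetric] Y_def[symmetric]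
  define Se where "Se = (A - G)\<^sup>2 + 4 * B\<^sup>2 + Y\<^sup>2"
  define Sf where "Sf = (A + G)\<^sup>2 + Y\<^sup>2"
  note roots = e_plus_def[folded Se_def] e_minus_def[folded Se_def] f_plus_def[folded Sf_def]
    f_minus_def[folded Sf_def]
  have H: "0 < H" "H < 1" and Y: "0 \<le> Y"
    using sgad_H_bounds[OF assms(1-3), of r] sgad_Y_nonneg[OF assms(1-3), of r]
    by (simp_all add: H_def Y_def)
  have S: "Se \<ge> 0" "Sf \<ge> 0" by (simp_all add: Se_def Sf_def)
  have dets: "(1 + H)\<^sup>2 - Sf = (1 - H)\<^sup>2 - Se"
    using sgad_block_dets_eq[of g Nth r t \<Phi>] unfolding defs Se_def[symmetric] Sf_def[symmetric] .
  have det0: "(1 - H)\<^sup>2 - Se = 0 \<longleftrightarrow> Nth = 0 \<and> r = 0"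
    using sgad_block_det_eq_0_iff[OF assms(1-3), of r \<Phi>] unfolding defs Se_def[symmetric] .
  \<comment> \<open>Each product is a block determinant. As the plus roots are positive, a minus
    root vanishes exactly when its determinant does.\<close>
  have "e_plus * e_minus = ((1 - H)\<^sup>2 - Se) / 4" "f_plus * f_minus = ((1 + H)\<^sup>2 - Sf) / 4"
    using S by (simp_all add: roots field_simps power2_eq_square)
  moreover have "e_plus > 0" "f_plus > 0"
    using S H by (simp_all add: roots add_pos_nonneg)
  ultimately have e0: "e_minus = 0 \<longleftrightarrow> Nth = 0 \<and> r = 0" and f0: "f_minus = 0 \<longleftrightarrow> Nth = 0 \<and> r = 0"
    using dets det0 by auto
  let ?c = complex_of_real
  \<comment> \<open>The inner off-diagonal entries are complex conjugates, with product ((A - G)^2 +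
    4 B^2) / 4.\<close>
  define a b d p q r' s where m: "a = ?c ((1 - Y + H) / 2)" "b = ?c ((A + G) / 2)" "d = ?c ((1 + Y + H) / 2)"
    "p = ?c ((1 + Y - H) / 2)" "q = Complex ((A - G) / 2) (- B)" "r' = Complex ((A - G) / 2) B"
    "s = ?c ((1 - Y - H) / 2)"
  have choi: "choi E = x_mat a b b d p q r' s"
    unfolding choi_sgad[OF assms(4)] defs m by (simp add: Complex_eq diff_divide_distrib add_divide_distrib)
  have tr: "a + d = ?c (1 + H)" "p + s = ?c (1 - H)"
    unfolding m of_real_add[symmetric] by (simp_all add: field_simps)
  have det_f: "a * d - b * b = ?c (((1 + H)\<^sup>2 - Sf) / 4)"
    unfolding m of_real_mult[symmetric] of_real_diff[symmetric] of_real_eq_iff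
    by (simp add: Sf_def power2_eq_square field_simps)
  have det_e: "p * s - q * r' = ?c (((1 - H)\<^sup>2 - Se) / 4)"
    unfolding m by (simp add: complex_eq_iff Se_def power2_eq_square field_simps)
  have cp: "char_poly (choi E) = (\<Prod>x\<leftarrow>[e_plus, e_minus, f_plus, f_minus]. [:- complex_of_real x, 1:])"
    unfolding choi char_poly_x_mat tr det_f det_e quadratic_roots[OF S(1)] quadratic_roots[OF S(2)]
    unfolding roots
    by (simp only: list.map prod_list.Cons prod_list.Nil mult_1_left mult_1_right mult_ac)
  then have ev: "{x. eigenvalue (choi E) x} = complex_of_real ` {e_plus, e_minus, f_plus, f_minus}"
    using eigenvalues_if_char_poly_splits[of "choi E" 4 "map complex_of_real [e_plus, e_minus, f_plus, f_minus]"]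
    by (simp add: choi comp_def)
  \<comment> \<open>Neither block is zero, so each has rank 1 or 2; the equal determinants make both
    ranks drop together.\<close>
  have "d \<noteq> 0" "p \<noteq> 0"
    using H Y unfolding m of_real_eq_0_iff by auto
  moreover have "a * d - b * b = 0 \<longleftrightarrow> Nth = 0 \<and> r = 0" "p * s - q * r' = 0 \<longleftrightarrow> Nth = 0 \<and> r = 0"
    unfolding det_f det_e of_real_eq_0_iff dets using det0 by simp_all
  ultimately have rank: "vec_space.rank 4 (choi E) = (if Nth = 0 \<and> r = 0 then 2 else 4)"
    unfolding choi rank_x_mat right_minus_eq by (simp add: rank2_def)
  show "{x. eigenvalue (choi E) x} = complex_of_real ` {e_plus, e_minus, f_plus, f_minus}"
    "char_poly (choi E) =
      (\<Prod>x\<leftarrow>[e_plus, e_minus, f_plus, f_minus]. [:- complex_of_real x, 1:])"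
    "e_minus = 0 \<longleftrightarrow> Nth = 0 \<and> r = 0" "f_minus = 0 \<longleftrightarrow> Nth = 0 \<and> r = 0"
    "vec_space.rank 4 (choi E) = (if Nth = 0 \<and> r = 0 then 2 else 4)"
    by fact+
qed

section \<open>Pauli channels of every rank\<close>

lemma pauli_channel_choi_rank_exists:
  assumes "k \<in> {1, 2, 3, 4}"
  shows "\<exists>E. is_pauli_channel E \<and> vec_space.rank 4 (choi E) = k"
proof -
  define P :: "real \<Rightarrow> real \<Rightarrow> real \<Rightarrow> real \<Rightarrow> complex mat \<Rightarrow> complex mat" where
    "P = (\<lambda>\<alpha> \<beta> \<gamma> \<delta> \<rho>. complex_of_real \<alpha> \<cdot>\<^sub>m \<rho>
              + complex_of_real \<beta> \<cdot>\<^sub>m (pauli_x * \<rho> * pauli_x)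
              + complex_of_real \<gamma> \<cdot>\<^sub>m (pauli_y * \<rho> * pauli_y)
              + complex_of_real \<delta> \<cdot>\<^sub>m (pauli_z * \<rho> * pauli_z))"
  have channel: "is_pauli_channel (P \<alpha> \<beta> \<gamma> \<delta>)"
    if "0 \<le> \<alpha>" "0 \<le> \<beta>" "0 \<le> \<gamma>" "0 \<le> \<delta>" "\<alpha> + \<beta> + \<gamma> + \<delta> = 1" for \<alpha> \<beta> \<gamma> \<delta>
    unfolding is_pauli_channel_def P_def using that by blast
  have rank: "vec_space.rank 4 (choi (P \<alpha> \<beta> \<gamma> \<delta>)) =
      rank2 (complex_of_real (\<alpha> + \<delta>)) (of_real (\<alpha> - \<delta>)) (of_real (\<alpha> - \<delta>)) (of_real (\<alpha> + \<delta>))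
      + rank2 (complex_of_real (\<beta> + \<gamma>)) (of_real (\<beta> - \<gamma>)) (of_real (\<beta> - \<gamma>)) (of_real (\<beta> + \<gamma>))"
    for \<alpha> \<beta> \<gamma> \<delta>
    unfolding P_def choi_pauli rank_x_mat ..
  \<comment> \<open>The witnesses spread the probability evenly over k of the four Pauli
    operators.\<close>
  from assms consider "k = 1" | "k = 2" | "k = 3" | "k = 4" by auto
  then show ?thesis
  proof cases
    case 1 then show ?thesis
      by (intro exI[of _ "P 1 0 0 0"]) (simp add: channel rank rank2_def)
  next
    case 2 then show ?thesis
      by (intro exI[of _ "P (1/2) 0 0 (1/2)"]) (simp add: channel rank rank2_def)
  next
    case 3 then show ?thesis
      by (intro exI[of _ "P (1/3) (1/3) 0 (1/3)"]) (simp add: channel rank rank2_def)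
  next
    case 4 then show ?thesis
      by (intro exI[of _ "P (1/4) (1/4) (1/4) (1/4)"]) (simp add: channel rank rank2_def)
  qed
qed

theorem mainTheorem2:
  shows
    "(\<forall>(g::real) (Nth::real) (r::real) (\<Phi>::real) (t::real) (E :: complex mat \<Rightarrow> complex mat).
        g > 0 \<longrightarrow> Nth \<ge> 0 \<longrightarrow> t > 0 \<longrightarrow> is_sgad_channel g Nth r \<Phi> t E \<longrightarrow>
        (let A = sgad_A g Nth r \<Phi> t; G = sgad_G g Nth r \<Phi> t; B = sgad_B g Nth r \<Phi> t;
             H = sgad_H g Nth r t; Y = sgad_Y g Nth r t;
             e_plus  = 1/2 * (1 - H + sqrt ((A - G)\<^sup>2 + 4 * B\<^sup>2 + Y\<^sup>2));
             e_minus = 1/2 * (1 - H - sqrt ((A - G)\<^sup>2 + 4 * B\<^sup>2 + Y\<^sup>2));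
             f_plus  = 1/2 * (1 + H + sqrt ((A + G)\<^sup>2 + Y\<^sup>2));
             f_minus = 1/2 * (1 + H - sqrt ((A + G)\<^sup>2 + Y\<^sup>2))
         in {x. eigenvalue (choi E) x} = complex_of_real ` {e_plus, e_minus, f_plus, f_minus} \<and>
            char_poly (choi E) =
              (\<Prod>x\<leftarrow>[e_plus, e_minus, f_plus, f_minus]. [:- complex_of_real x, 1:]) \<and>
            (e_minus = 0 \<longleftrightarrow> f_minus = 0) \<and>
            (e_minus = 0 \<longleftrightarrow> Nth = 0 \<and> r = 0) \<and>
            vec_space.rank 4 (choi E) = (if Nth = 0 \<and> r = 0 then 2 else 4))) \<and>
     (\<forall>k \<in> {1, 2, 3, 4}. \<exists>E. is_pauli_channel E \<and> vec_space.rank 4 (choi E) = k)"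
proof (intro conjI allI impI ballI, goal_cases)
  case (1 g Nth r \<Phi> t E)
  note sgad = choi_sgad_spectrum_rank[OF 1]
  show ?case
    \<comment> \<open>Both vanishing conditions turn into the same condition on \<open>Nth\<close>
      and \<open>r\<close>, so the equivalences become reflexive.\<close>
    unfolding Let_def sgad(3,4) by (intro conjI refl sgad(1,2,5))
next
  case (2 k)
  then show ?case by (rule pauli_channel_choi_rank_exists)
qed

end
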